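(* Let $G_1$ and $G_2$ be finite simple connected graphs, where $G_1$ has at least one edge (so that the subdivision-edge join $G_1\veebar G_2$ is connected). Then the eccentricity matrix $\epsilon(G_1\veebar G_2)$ is irreducible.
   Context: All graphs are finite, simple and undirected. The subdivision graph $S(G)$ of a graph $G$ is obtained from $G$ by subdividing each edge with one new vertex; $I(G)$ is the set of these new vertices, so $V(S(G))=V(G)\cup I(G)$. For vertex-disjoint graphs $G_1,G_2$, the subdivision-edge join $G_1\veebar G_2$ is obtained from $S(G_1)$ and $G_2$ by joining each vertex of $I(G_1)$ to every vertex of $V(G_2)$ (the vertices of $V(G_1)$ receive no new edges). For a connected graph $G$ with distance function $d$, the eccentricity of a vertex $v$ is $e(v)=\max\{d(v,u):u\in V(G)\}$. The eccentricity matrix $\epsilon(G)$ is the symmetric matrix indexed by $V(G)$ with $(u,v)$ entry $d(u,v)$ if $d(u,v)=\min\{e(u),e(v)\}$, and $0$ otherwise. A square matrix $N$ is reducible if there is a permutation matrix $P$ with $N=P^T\begin{pmatrix}A&B\\0&C\end{pmatrix}P$, where $A$ and $C$ are (nonempty) square blocks; it is irreducible otherwise. *)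

theory Defs
  imports
    "Graph_Theory.Graph_Theory"
    "Jordan_Normal_Form.Matrix"
begin

text \<open>
  A finite simple undirected graph is a \<open>pair_graph\<close> of the library: finitely many vertices
  and a symmetric, irreflexive arc relation. An undirected edge is thus a pair of opposite
  arcs; as a single object it is the two-element set of its endpoints.
\<close>

definition undirected_edges :: "'a pair_pre_digraph \<Rightarrow> 'a set set" where
  "undirected_edges G = {{u, v} |u v. (u, v) \<in> parcs G}"

text \<open>In the subdivision graph, \<open>Inl v\<close> is an original vertex and \<open>Inr e\<close> is the new
  vertex subdividing the edge \<open>e\<close>.\<close>

definition new_vertices :: "'a pair_pre_digraph \<Rightarrow> ('a + 'a set) set" where
  "new_vertices G = Inr ` undirected_edges G"

definition subdivision_graph :: "'a pair_pre_digraph \<Rightarrow> ('a + 'a set) pair_pre_digraph" where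
  "subdivision_graph G =
    \<lparr> pverts = Inl ` pverts G \<union> new_vertices G,
      parcs = (\<Union>e\<in>undirected_edges G. \<Union>v\<in>e. {(Inl v, Inr e), (Inr e, Inl v)}) \<rparr>"

text \<open>The sum type makes the two graphs vertex-disjoint.\<close>

definition subdivision_edge_join ::
  "'a pair_pre_digraph \<Rightarrow> 'b pair_pre_digraph \<Rightarrow> (('a + 'a set) + 'b) pair_pre_digraph" where
  "subdivision_edge_join G1 G2 =
    \<lparr> pverts = Inl ` pverts (subdivision_graph G1) \<union> Inr ` pverts G2,
      parcs = map_prod Inl Inl ` parcs (subdivision_graph G1)
            \<union> map_prod Inr Inr ` parcs G2
            \<union> Inl ` new_vertices G1 \<times> Inr ` pverts G2
            \<union> Inr ` pverts G2 \<times> Inl ` new_vertices G1 \<rparr>"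

text \<open>The shortest-path value \<open>\<mu>\<close> with unit weights is the infimum of the lengths of the walks
  from \<open>u\<close> to \<open>v\<close>. It is an extended real, infinite for unreachable pairs; the
  conversion to \<open>real\<close> is only meaningful in a connected graph.\<close>

definition graph_dist :: "'a pair_pre_digraph \<Rightarrow> 'a \<Rightarrow> 'a \<Rightarrow> real" where
  "graph_dist G u v = real_of_ereal (wf_digraph.\<mu> (with_proj G) (\<lambda>_. 1) u v)"

definition eccentricity :: "'a pair_pre_digraph \<Rightarrow> 'a \<Rightarrow> real" where
  "eccentricity G v = Max {graph_dist G v u |u. u \<in> pverts G}"

text \<open>Library matrices are indexed by numbers, so the matrix is formed relative to a list \<open>vs\<close>
  enumerating the vertex set without repetition.\<close>

definition eccentricity_matrix :: "'a pair_pre_digraph \<Rightarrow> 'a list \<Rightarrow> real mat" where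
  "eccentricity_matrix G vs = mat (length vs) (length vs) (\<lambda>(i, j).
     if graph_dist G (vs ! i) (vs ! j) = min (eccentricity G (vs ! i)) (eccentricity G (vs ! j))
     then graph_dist G (vs ! i) (vs ! j) else 0)"

definition permutation_matrix :: "nat \<Rightarrow> 'a::semiring_1 mat \<Rightarrow> bool" where
  "permutation_matrix n P \<longleftrightarrow>
    (\<exists>p. p permutes {..<n} \<and> P = mat n n (\<lambda>(i, j). if j = p i then 1 else 0))"

definition reducible_matrix :: "'a::semiring_1 mat \<Rightarrow> bool" where
  "reducible_matrix N \<longleftrightarrow> square_mat N \<and>
    (\<exists>P A B C k m. k > 0 \<and> m > 0 \<and> permutation_matrix (k + m) P \<and>
       A \<in> carrier_mat k k \<and> B \<in> carrier_mat k m \<and> C \<in> carrier_mat m m \<and>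
       N = transpose_mat P * four_block_mat A B (0\<^sub>m m k) C * P)"

definition irreducible_matrix :: "'a::semiring_1 mat \<Rightarrow> bool" where
  "irreducible_matrix N \<longleftrightarrow> square_mat N \<and> \<not> reducible_matrix N"

end

theory Submission
  imports Defs
begin

text \<open>
  It suffices that the support graph of the symmetric eccentricity matrix is connected. Every
  \<open>g \<in> V(G\<^sub>2)\<close> has eccentricity 2, attained at every original vertex \<open>v \<in> V(G\<^sub>1)\<close>, and
  \<open>e(v) \<ge> d(v,g) = 2\<close>; hence the entries at \<open>(v,g)\<close> are all nonzero. A subdivision vertex \<open>e\<close> that
  is not incident with some \<open>v\<close> has eccentricity \<open>3 = d(e,v) \<le> e(v)\<close>, so the entry at \<open>(e,v)\<close> is
  nonzero. If \<open>e\<close> is incident with every vertex then \<open>G\<^sub>1 = K\<^sub>2\<close> and \<open>e\<close> has eccentricity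
  \<open>1 = d(e,g)\<close>, so the entry at \<open>(e,g)\<close> is nonzero.
\<close>

section \<open>Irreducibility\<close>

text \<open>Row \<open>a\<close> of \<open>P\<close> has its only 1 in column \<open>p a\<close>.
  Since \<open>p\<close> is injective, the double sum for the entry collapses to the single term at
  row \<open>i\<close> and column \<open>j\<close>.\<close>

lemma permutation_conjugate_entry:
  fixes M P :: "'a::semiring_1 mat"
  assumes p: "p permutes {..<n}" and P: "P = mat n n (\<lambda>(i, j). if j = p i then 1 else 0)"
    and M: "M \<in> carrier_mat n n" and i: "i < n" and j: "j < n"
  shows "(transpose_mat P * M * P) $$ (p i, p j) = M $$ (i, j)"
proof -
  have pi: "p x < n \<longleftrightarrow> x < n" for x
    using permutes_in_image[OF p, of x] by simp
  have inj: "p x = p y \<longleftrightarrow> x = y" for x y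
    using permutes_inj[OF p] by (auto dest: injD)
  have "(transpose_mat P * M) $$ (p i, b) = M $$ (i, b)" if "b < n" for b
  proof -
    have "(transpose_mat P * M) $$ (p i, b) = (\<Sum>a<n. (if p i = p a then 1 else 0) * M $$ (a, b))"
      using that M i pi by (simp add: P scalar_prod_def lessThan_atLeast0)
    also have "\<dots> = (\<Sum>a<n. if a = i then M $$ (a, b) else 0)"
      by (intro sum.cong) (auto simp: inj)
    finally show ?thesis using i by simp
  qed
  then have "(transpose_mat P * M * P) $$ (p i, p j)
      = (\<Sum>b<n. M $$ (i, b) * (if p j = p b then 1 else 0))"
    using M i j pi by (simp add: P scalar_prod_def lessThan_atLeast0)
  also have "\<dots> = (\<Sum>b<n. if b = j then M $$ (i, b) else 0)"
    by (intro sum.cong) (auto simp: inj)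
  finally show ?thesis using j by simp
qed

text \<open>In a reducible form the zero block lies in the first \<open>k\<close> columns, below the
  first \<open>k\<close> rows. If \<open>S\<close> is the image of \<open>{..<k}\<close> under
  \<open>p\<close>, conjugation turns it into zeros at all rows outside \<open>S\<close> and columns
  in \<open>S\<close>, contradicting \<open>cut\<close>.\<close>

lemma irreducible_matrixI:
  fixes N :: "'a::semiring_1 mat"
  assumes sq: "N \<in> carrier_mat n n"
    and cut: "\<And>S. S \<subset> {..<n} \<Longrightarrow> S \<noteq> {} \<Longrightarrow> \<exists>i\<in>{..<n} - S. \<exists>j\<in>S. N $$ (i, j) \<noteq> 0"
  shows "irreducible_matrix N"
  unfolding irreducible_matrix_def
proof
  show "square_mat N" using sq by simp
  show "\<not> reducible_matrix N"
  proof
    assume "reducible_matrix N"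
    then obtain P A B C k m where k: "k > 0" and m: "m > 0"
      and P: "permutation_matrix (k + m) P"
      and blocks: "A \<in> carrier_mat k k" "B \<in> carrier_mat k m" "C \<in> carrier_mat m m"
      and N: "N = transpose_mat P * four_block_mat A B (0\<^sub>m m k) C * P"
      unfolding reducible_matrix_def by blast
    from P obtain p where p: "p permutes {..<k + m}"
      and P: "P = mat (k + m) (k + m) (\<lambda>(i, j). if j = p i then 1 else 0)"
      unfolding permutation_matrix_def by blast
    have "dim_row N = k + m" unfolding N P by simp
    then have n: "n = k + m" using sq by simp
    have F: "four_block_mat A B (0\<^sub>m m k) C \<in> carrier_mat (k + m) (k + m)"
      using blocks by simp
    have img: "p ` {..<n} = {..<n}" using permutes_image[OF p] n by simp
    have inj: "inj p" using permutes_inj[OF p] .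
    \<comment> \<open>The image is a proper subset because \<open>m > 0\<close>: \<open>k\<close> is
      an index outside \<open>{..<k}\<close>, and injectivity keeps \<open>p k\<close> outside the
      image.\<close>
    have "p k \<in> {..<n} - p ` {..<k}" "p ` {..<k} \<subseteq> {..<n}"
      using img m inj n by (auto simp: inj_image_mem_iff)
    then have "p ` {..<k} \<subset> {..<n}" by blast
    moreover have "p ` {..<k} \<noteq> {}" using k by auto
    ultimately have "\<exists>i\<in>{..<n} - p ` {..<k}. \<exists>j\<in>p ` {..<k}. N $$ (i, j) \<noteq> 0"
      by (rule cut)
    then obtain i j where i: "i < n" "i \<notin> p ` {..<k}" and j: "j \<in> p ` {..<k}"
      and nz: "N $$ (i, j) \<noteq> 0" by auto
    have "i \<in> p ` {..<n}" using i img by simp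
    then obtain i' where i': "i = p i'" "i' < n" by blast
    then have "\<not> i' < k" using i by blast
    obtain j' where j': "j = p j'" "j' < k" using j by blast
    have "N $$ (i, j) = four_block_mat A B (0\<^sub>m m k) C $$ (i', j')"
      using permutation_conjugate_entry[OF p P F, of i' j'] i' j' n by (simp add: N)
    also have "\<dots> = 0" using blocks i' \<open>\<not> i' < k\<close> j' n by simp
    finally show False using nz by simp
  qed
qed

section \<open>Distance and eccentricity\<close>

context pair_wf_digraph
begin

text \<open>With walks traded for relation powers, distances can be checked by unfolding
  compositions. The conjunct \<open>u \<in> pverts G\<close> matters for \<open>n = 0\<close>, where
  the power is the identity on the whole type.\<close>

lemma awalk_of_length_iff:
  "(\<exists>p. awalk u p v \<and> length p = n) \<longleftrightarrow> u \<in> pverts G \<and> (u, v) \<in> parcs G ^^ n"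
proof (induction n arbitrary: u)
  case 0
  then show ?case by (auto simp: awalk_Nil_iff)
next
  case (Suc n)
  have "(\<exists>p. awalk u p v \<and> length p = Suc n)
      \<longleftrightarrow> (\<exists>w. (u, w) \<in> parcs G \<and> (\<exists>p. awalk w p v \<and> length p = n))"
  proof
    assume "\<exists>p. awalk u p v \<and> length p = Suc n"
    then show "\<exists>w. (u, w) \<in> parcs G \<and> (\<exists>p. awalk w p v \<and> length p = n)"
      by (auto simp: length_Suc_conv awalk_Cons_iff) blast
  next
    assume "\<exists>w. (u, w) \<in> parcs G \<and> (\<exists>p. awalk w p v \<and> length p = n)"
    then obtain w p where "(u, w) \<in> parcs G" "awalk w p v" "length p = n" by blast
    then show "\<exists>p. awalk u p v \<and> length p = Suc n"
      by (intro exI[of _ "(u, w) # p"]) (simp add: awalk_Cons_iff)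
  qed
  also have "\<dots> \<longleftrightarrow> (\<exists>w. (u, w) \<in> parcs G \<and> (w, v) \<in> parcs G ^^ n)"
    unfolding Suc.IH using in_arcsD2 by blast
  \<comment> \<open>The walk is split at its first arc, while \<open>^^\<close> adds the new factor
    at the end; \<open>relpow_commute\<close> reconciles the two.\<close>
  also have "\<dots> \<longleftrightarrow> u \<in> pverts G \<and> (u, v) \<in> parcs G ^^ Suc n"
    using in_arcsD1 by (auto simp: relpow_commute[symmetric])
  finally show ?case .
qed

text \<open>The infimum \<open>\<mu>\<close> is attained by a walk of length \<open>n\<close>, so it
  is finite and the conversion to \<open>real\<close> is exact.\<close>

lemma graph_dist_eqI:
  assumes u: "u \<in> pverts G" and n: "(u, v) \<in> parcs G ^^ n"
    and min: "\<And>m. m < n \<Longrightarrow> (u, v) \<notin> parcs G ^^ m"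
  shows "graph_dist G u v = real n"
proof -
  have cost: "awalk_cost (\<lambda>_. 1) p = real (length p)" for p
    by (simp add: awalk_cost_def sum_list_triv)
  have "\<mu> (\<lambda>_. 1) u v = ereal (real n)"
    unfolding \<mu>_def cost
  proof (rule INF_eqI)
    fix p assume "p \<in> {p. awalk u p v}"
    then have "(u, v) \<in> parcs G ^^ length p"
      using awalk_of_length_iff[of u v "length p"] by blast
    then show "ereal (real n) \<le> ereal (real (length p))"
      using min[of "length p"] by (cases "length p < n") simp_all
  next
    fix y assume y: "\<And>p. p \<in> {p. awalk u p v} \<Longrightarrow> y \<le> ereal (real (length p))"
    obtain p where "awalk u p v" "length p = n"
      using awalk_of_length_iff[of u v n] u n by blast
    then show "y \<le> ereal (real n)" using y by blast
  qed
  then show ?thesis unfolding graph_dist_def by simp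
qed

text \<open>One walk suffices for a least walk length to exist, and that length is the distance by
  \<open>graph_dist_eqI\<close>.\<close>

lemma graph_dist_le:
  assumes u: "u \<in> pverts G" and n: "(u, v) \<in> parcs G ^^ n"
  shows "graph_dist G u v \<le> real n"
proof -
  let ?m = "LEAST m. (u, v) \<in> parcs G ^^ m"
  have "graph_dist G u v = real ?m"
    using u n by (intro graph_dist_eqI) (auto intro: LeastI dest: not_less_Least)
  then show ?thesis using Least_le[of "\<lambda>m. (u, v) \<in> parcs G ^^ m", OF n] by simp
qed

lemma graph_dist_self: "u \<in> pverts G \<Longrightarrow> graph_dist G u u = 0"
  using graph_dist_eqI[of u u 0] by simp

lemma graph_dist_eq_1: "(u, v) \<in> parcs G \<Longrightarrow> u \<noteq> v \<Longrightarrow> graph_dist G u v = 1"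
  using graph_dist_eqI[of u v 1] in_arcsD1 by simp

lemma graph_dist_eq_2:
  assumes "(u, w) \<in> parcs G" "(w, v) \<in> parcs G" "u \<noteq> v" "(u, v) \<notin> parcs G"
  shows "graph_dist G u v = 2"
proof -
  have "graph_dist G u v = real 2"
    using assms in_arcsD1 by (intro graph_dist_eqI) (auto simp: numeral_2_eq_2 less_Suc_eq)
  then show ?thesis by simp
qed

lemma graph_dist_eq_3:
  assumes "(u, w) \<in> parcs G" "(w, w') \<in> parcs G" "(w', v) \<in> parcs G"
    and "u \<noteq> v" "(u, v) \<notin> parcs G" "\<And>x. (u, x) \<in> parcs G \<Longrightarrow> (x, v) \<notin> parcs G"
  shows "graph_dist G u v = 3"
proof -
  have "graph_dist G u v = real 3"
    using assms in_arcsD1 by (intro graph_dist_eqI) (auto simp: numeral_3_eq_3 less_Suc_eq)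
  then show ?thesis by simp
qed

end

text \<open>Reversing walks preserves length, so both infima range over the same set of lengths;
  with unit weights the cost of a walk is its length.\<close>

lemma (in pair_sym_digraph) graph_dist_commute: "graph_dist G u v = graph_dist G v u"
proof -
  have rev: "length (rev_path p) = length p" for p :: "('a \<times> 'a) list"
    by (induction p) auto
  have "length ` {p. awalk u p v} \<subseteq> length ` {p. awalk v p u}" for u v
    by (auto simp: rev intro!: image_eqI[of _ _ "rev_path _"] awalk_rev_path')
  then have "length ` {p. awalk u p v} = length ` {p. awalk v p u}"
    by (simp add: subset_antisym)
  then have "(\<lambda>l. ereal (real l)) ` length ` {p. awalk u p v}
      = (\<lambda>l. ereal (real l)) ` length ` {p. awalk v p u}" by simp
  then show ?thesis
    unfolding graph_dist_def \<mu>_def awalk_cost_def by (simp add: image_image sum_list_triv)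
qed

section \<open>Eccentricity and the entries of the matrix\<close>

context
  fixes G :: "'a pair_pre_digraph"
  assumes finite_verts: "finite (pverts G)"
begin

lemma graph_dist_le_eccentricity:
  assumes "w \<in> pverts G"
  shows "graph_dist G v w \<le> eccentricity G v"
  unfolding eccentricity_def using assms finite_verts by (intro Max_ge) auto

lemma eccentricity_eqI:
  assumes "w \<in> pverts G" "graph_dist G v w = c" "\<And>u. u \<in> pverts G \<Longrightarrow> graph_dist G v u \<le> c"
  shows "eccentricity G v = c"
  unfolding eccentricity_def using assms finite_verts by (intro Max_eqI) auto

end

text \<open>Indexing by vertices instead of positions keeps the enumeration \<open>vs\<close> out of
  the arguments about the join.\<close>

definition eccentricity_entry :: "'a pair_pre_digraph \<Rightarrow> 'a \<Rightarrow> 'a \<Rightarrow> real" where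
  "eccentricity_entry G x y =
    (if graph_dist G x y = min (eccentricity G x) (eccentricity G y) then graph_dist G x y else 0)"

lemma (in pair_sym_digraph) eccentricity_entry_commute:
  "eccentricity_entry G x y = eccentricity_entry G y x"
  unfolding eccentricity_entry_def by (simp add: graph_dist_commute[of x y] min.commute)

text \<open>The hypothesis \<open>closed\<close> expresses connectedness of the support graph. A
  proper nonempty index set \<open>S\<close> yields a proper nonempty vertex set, which therefore
  cannot be closed, and this gives the nonzero entry required by
  \<open>irreducible_matrixI\<close>.\<close>

lemma eccentricity_matrix_irreducibleI:
  assumes "distinct vs"
    and closed: "\<And>W. W \<subseteq> set vs \<Longrightarrow> W \<noteq> {} \<Longrightarrow>
      (\<And>x y. y \<in> W \<Longrightarrow> x \<in> set vs \<Longrightarrow> eccentricity_entry G x y \<noteq> 0 \<Longrightarrow> x \<in> W) \<Longrightarrow> W = set vs"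
  shows "irreducible_matrix (eccentricity_matrix G vs)"
proof (rule irreducible_matrixI)
  let ?N = "eccentricity_matrix G vs"
  show "?N \<in> carrier_mat (length vs) (length vs)"
    by (simp add: eccentricity_matrix_def)
  fix S assume S: "S \<subset> {..<length vs}" "S \<noteq> {}"
  \<comment> \<open>Distinctness of \<open>vs\<close> is what makes a proper \<open>S\<close> have a
    proper image.\<close>
  have in_W: "vs ! i \<in> (!) vs ` S \<longleftrightarrow> i \<in> S" if "i < length vs" for i
    using that S nth_eq_iff_index_eq[OF \<open>distinct vs\<close>] by (fastforce simp: image_iff)
  have "(!) vs ` S \<noteq> set vs"
    using S in_W by (metis lessThan_iff nth_mem psubset_imp_ex_mem DiffE)
  then obtain x y where "y \<in> (!) vs ` S" "x \<in> set vs" "eccentricity_entry G x y \<noteq> 0" "x \<notin> (!) vs ` S"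
    using closed[of "(!) vs ` S"] S by fastforce
  then obtain i j where "i < length vs" "i \<notin> S" "j \<in> S" "eccentricity_entry G (vs ! i) (vs ! j) \<noteq> 0"
    by (auto simp: in_set_conv_nth)
  then show "\<exists>i\<in>{..<length vs} - S. \<exists>j\<in>S. ?N $$ (i, j) \<noteq> 0"
    using S by (intro bexI[of _ i] bexI[of _ j])
      (auto simp: eccentricity_matrix_def eccentricity_entry_def)
qed

section \<open>The subdivision-edge join\<close>

lemma pverts_join:
  "pverts (subdivision_edge_join G1 G2)
    = Inl ` Inl ` pverts G1 \<union> Inl ` Inr ` undirected_edges G1 \<union> Inr ` pverts G2"
  by (auto simp: subdivision_edge_join_def subdivision_graph_def new_vertices_def)

lemma in_pverts_join:
  "Inl (Inl v) \<in> pverts (subdivision_edge_join G1 G2) \<longleftrightarrow> v \<in> pverts G1"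
  "Inl (Inr e) \<in> pverts (subdivision_edge_join G1 G2) \<longleftrightarrow> e \<in> undirected_edges G1"
  "Inr g \<in> pverts (subdivision_edge_join G1 G2) \<longleftrightarrow> g \<in> pverts G2"
  by (auto simp: pverts_join)

text \<open>The adjacency table for all nine pairs of vertex kinds: original
  \<open>Inl (Inl v)\<close>, new \<open>Inl (Inr e)\<close>, and right-hand
  \<open>Inr g\<close>.\<close>

lemma parcs_join:
  "(Inl (Inl v), Inl (Inl v')) \<notin> parcs (subdivision_edge_join G1 G2)"
  "(Inl (Inr e), Inl (Inr e')) \<notin> parcs (subdivision_edge_join G1 G2)"
  "(Inl (Inl v), Inr g) \<notin> parcs (subdivision_edge_join G1 G2)"
  "(Inr g, Inl (Inl v)) \<notin> parcs (subdivision_edge_join G1 G2)"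
  "(Inl (Inl v), Inl (Inr e)) \<in> parcs (subdivision_edge_join G1 G2)
    \<longleftrightarrow> e \<in> undirected_edges G1 \<and> v \<in> e"
  "(Inl (Inr e), Inl (Inl v)) \<in> parcs (subdivision_edge_join G1 G2)
    \<longleftrightarrow> e \<in> undirected_edges G1 \<and> v \<in> e"
  "(Inl (Inr e), Inr g) \<in> parcs (subdivision_edge_join G1 G2)
    \<longleftrightarrow> e \<in> undirected_edges G1 \<and> g \<in> pverts G2"
  "(Inr g, Inl (Inr e)) \<in> parcs (subdivision_edge_join G1 G2)
    \<longleftrightarrow> e \<in> undirected_edges G1 \<and> g \<in> pverts G2"
  "(Inr g, Inr g') \<in> parcs (subdivision_edge_join G1 G2) \<longleftrightarrow> (g, g') \<in> parcs G2"
  by (auto simp: subdivision_edge_join_def subdivision_graph_def new_vertices_def)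

lemma undirected_edge_subset:
  assumes "pair_wf_digraph G" "e \<in> undirected_edges G"
  shows "e \<subseteq> pverts G"
  using assms pair_wf_digraph.wellformed'[of G] unfolding undirected_edges_def by blast

lemma join_pair_sym_digraph:
  assumes "pair_sym_digraph G1" "pair_sym_digraph G2"
  shows "pair_sym_digraph (subdivision_edge_join G1 G2)" (is "pair_sym_digraph ?J")
proof -
  interpret G1: pair_sym_digraph G1 by fact
  interpret G2: pair_sym_digraph G2 by fact
  have arc: "x \<in> pverts ?J \<and> y \<in> pverts ?J \<and> (y, x) \<in> parcs ?J" if "(x, y) \<in> parcs ?J" for x y
  proof -
    have e: "v \<in> pverts G1" if "e \<in> undirected_edges G1" "v \<in> e" for e v
      using undirected_edge_subset[OF G1.pair_wf_digraph_axioms] that by blast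
    have g: "a \<in> pverts G2 \<and> b \<in> pverts G2 \<and> (b, a) \<in> parcs G2" if "(a, b) \<in> parcs G2" for a b
      using that G2.wellformed' G2.arcs_symmetric by blast
    show ?thesis
      using that e g by (cases x; cases "projl x"; cases y; cases "projl y")
        (simp_all add: parcs_join in_pverts_join, blast+)
  qed
  show ?thesis
    by unfold_locales (use arc in \<open>auto simp: symmetric_def intro: symI\<close>)
qed

text \<open>An arc that is not a loop provides a vertex \<open>w\<close> other than
  \<open>v\<close>; the first arc of a walk from \<open>v\<close> to \<open>w\<close> gives the
  edge.\<close>

lemma connected_obtains_incident_edge:
  assumes "pair_graph G" "Digraph_Component.connected (with_proj G)" "parcs G \<noteq> {}"
    and v: "v \<in> pverts G"
  obtains e where "e \<in> undirected_edges G" "v \<in> e"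
proof -
  interpret pair_graph G by fact
  obtain a b where ab: "(a, b) \<in> parcs G" using assms(3) by auto
  then have "a \<noteq> b" "a \<in> pverts G" "b \<in> pverts G"
    using no_loops' wellformed' by auto
  then obtain w where w: "w \<in> pverts G" "w \<noteq> v" by metis
  have "strongly_connected G"
    using symmetric_connected_imp_strongly_connected assms(2) sym_arcs by simp
  then have "v \<rightarrow>\<^sup>*\<^bsub>G\<^esub> w" using v w by auto
  then obtain x where "(v, x) \<in> parcs G"
    using w by (cases rule: converse_reachable_cases) auto
  then show thesis using that[of "{v, x}"] by (auto simp: undirected_edges_def)
qed

locale subdivision_join =
  fixes G1 :: "'a pair_pre_digraph" and G2 :: "'b pair_pre_digraph"
  assumes pair_graphs: "pair_graph G1" "pair_graph G2"
    and conn: "Digraph_Component.connected (with_proj G1)"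
    and arcs: "parcs G1 \<noteq> {}"
    and nonempty: "pverts G2 \<noteq> {}"
begin

abbreviation J :: "(('a + 'a set) + 'b) pair_pre_digraph" where
  "J \<equiv> subdivision_edge_join G1 G2"

sublocale G1: pair_graph G1 by (fact pair_graphs)
sublocale G2: pair_graph G2 by (fact pair_graphs)
sublocale J: pair_sym_digraph J
  by (rule join_pair_sym_digraph) unfold_locales

lemma incident_edge:
  assumes "v \<in> pverts G1"
  obtains e where "e \<in> undirected_edges G1" "v \<in> e"
  using connected_obtains_incident_edge[OF pair_graphs(1) conn arcs assms] by blast

text \<open>Finiteness makes the \<open>Max\<close> in \<open>eccentricity\<close> a genuine
  maximum.\<close>

lemma finite_J: "finite (pverts J)"
proof -
  have "undirected_edges G1 \<subseteq> Pow (pverts G1)"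
    using undirected_edge_subset[OF G1.pair_wf_digraph] by blast
  then have "finite (undirected_edges G1)"
    using G1.pair_finite_verts by (simp add: finite_subset)
  then show ?thesis
    using G1.pair_finite_verts G2.pair_finite_verts by (simp add: pverts_join)
qed

section \<open>Distances in the join\<close>

lemma dist_original_right:
  assumes "v \<in> pverts G1" "g \<in> pverts G2"
  shows "graph_dist J (Inl (Inl v)) (Inr g) = 2"
proof -
  obtain e where "e \<in> undirected_edges G1" "v \<in> e" using incident_edge assms by blast
  then show ?thesis using assms
    by (intro J.graph_dist_eq_2[of _ "Inl (Inr e)"]) (auto simp: parcs_join)
qed

lemma dist_new_right:
  assumes "e \<in> undirected_edges G1" "g \<in> pverts G2"
  shows "graph_dist J (Inl (Inr e)) (Inr g) = 1"
  using assms by (intro J.graph_dist_eq_1) (auto simp: parcs_join)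

lemma dist_new_original_incident:
  assumes "e \<in> undirected_edges G1" "v \<in> e"
  shows "graph_dist J (Inl (Inr e)) (Inl (Inl v)) = 1"
  using assms by (intro J.graph_dist_eq_1) (auto simp: parcs_join)

text \<open>A shortest route is \<open>e\<close>, \<open>g\<close>, \<open>e'\<close>,
  \<open>v\<close> with \<open>e'\<close> incident with \<open>v\<close>. Length 2 is impossible:
  the neighbours of \<open>e\<close> are its endpoints and the vertices of \<open>G2\<close>, none
  adjacent to an original vertex.\<close>

lemma dist_new_original_nonincident:
  assumes e: "e \<in> undirected_edges G1" and v: "v \<in> pverts G1" "v \<notin> e"
  shows "graph_dist J (Inl (Inr e)) (Inl (Inl v)) = 3"
proof -
  obtain e' where "e' \<in> undirected_edges G1" "v \<in> e'" using incident_edge v by blast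
  moreover obtain g where "g \<in> pverts G2" using nonempty by blast
  moreover have "(x, Inl (Inl v)) \<notin> parcs J" if "(Inl (Inr e), x) \<in> parcs J" for x
    using that by (cases x; cases "projl x") (auto simp: parcs_join)
  ultimately show ?thesis using e v
    by (intro J.graph_dist_eq_3[of _ "Inr g" "Inl (Inr e')"]) (auto simp: parcs_join)
qed

text \<open>Any vertex of \<open>G2\<close> is a common neighbour. Only a bound is stated, since
  \<open>e\<close> and \<open>e'\<close> may coincide.\<close>

lemma dist_new_new:
  assumes "e \<in> undirected_edges G1" "e' \<in> undirected_edges G1"
  shows "graph_dist J (Inl (Inr e)) (Inl (Inr e')) \<le> 2"
proof -
  obtain g where "g \<in> pverts G2" using nonempty by blast
  then have "(Inl (Inr e), Inl (Inr e')) \<in> parcs J ^^ 2"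
    using assms by (auto simp: numeral_2_eq_2 parcs_join intro!: relcompI[of _ "Inr g"])
  then show ?thesis using J.graph_dist_le[of _ _ 2] assms by (simp add: pverts_join)
qed

lemma dist_right_right:
  assumes "g \<in> pverts G2" "g' \<in> pverts G2"
  shows "graph_dist J (Inr g) (Inr g') \<le> 2"
proof -
  obtain e where "e \<in> undirected_edges G1"
    using arcs by (auto simp: undirected_edges_def)
  then have "(Inr g, Inr g') \<in> parcs J ^^ 2"
    using assms by (auto simp: numeral_2_eq_2 parcs_join intro!: relcompI[of _ "Inl (Inr e)"])
  then show ?thesis using J.graph_dist_le[of _ _ 2] assms by (simp add: pverts_join)
qed

section \<open>Eccentricities in the join\<close>

lemma eccentricity_right:
  assumes g: "g \<in> pverts G2"
  shows "eccentricity J (Inr g) = 2"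
proof -
  obtain v where v: "v \<in> pverts G1" using arcs G1.wellformed' by fast
  show ?thesis
  proof (rule eccentricity_eqI[OF finite_J])
    show "Inl (Inl v) \<in> pverts J" using v by (simp add: pverts_join)
    show "graph_dist J (Inr g) (Inl (Inl v)) = 2"
      using v g dist_original_right by (simp add: J.graph_dist_commute[of "Inr g"])
    show "graph_dist J (Inr g) u \<le> 2" if "u \<in> pverts J" for u
      using that g dist_original_right dist_new_right dist_right_right
        J.graph_dist_commute[of "Inr g" "Inl _"]
      by (auto simp: pverts_join)
  qed
qed

lemma eccentricity_new_nonincident:
  assumes e: "e \<in> undirected_edges G1" and v: "v \<in> pverts G1" "v \<notin> e"
  shows "eccentricity J (Inl (Inr e)) = 3"
proof (rule eccentricity_eqI[OF finite_J])
  show "Inl (Inl v) \<in> pverts J" using v by (simp add: pverts_join)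
  show "graph_dist J (Inl (Inr e)) (Inl (Inl v)) = 3"
    using dist_new_original_nonincident assms .
  show "graph_dist J (Inl (Inr e)) u \<le> 3" if "u \<in> pverts J" for u
  proof -
    from that consider w where "u = Inl (Inl w)" "w \<in> pverts G1"
      | e' where "u = Inl (Inr e')" "e' \<in> undirected_edges G1"
      | g where "u = Inr g" "g \<in> pverts G2" by (auto simp: pverts_join)
    then show ?thesis
    proof cases
      case 1
      then show ?thesis using dist_new_original_incident[OF e, of w]
          dist_new_original_nonincident[OF e, of w] by (cases "w \<in> e") auto
    next
      case 2
      then show ?thesis using dist_new_new[OF e, of e'] by simp
    next
      case 3
      then show ?thesis using dist_new_right[OF e, of g] by simp
    qed
  qed
qed

text \<open>This is the case of \<open>G1\<close> being a single edge: without loops every edge has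
  two elements, and \<open>e'\<close> lies in \<open>pverts G1\<close>, hence in
  \<open>e\<close>.\<close>

lemma spanning_edge_unique:
  assumes e: "pverts G1 \<subseteq> e" "e \<in> undirected_edges G1" and e': "e' \<in> undirected_edges G1"
  shows "e' = e"
proof -
  have "card f = 2" if "f \<in> undirected_edges G1" for f
    using that G1.no_loops' by (auto simp: undirected_edges_def card_insert_if)
  then have "card e = 2" "card e' = 2" using e e' by simp_all
  moreover have "e' \<subseteq> e"
    using undirected_edge_subset[OF G1.pair_wf_digraph e'] e by blast
  ultimately show ?thesis
    \<comment> \<open>\<open>card.infinite\<close> enters because cardinality 2 forces
      \<open>e\<close> to be finite.\<close>
    by (metis card_subset_eq card.infinite zero_neq_numeral)
qed

text \<open>All original and right-hand vertices are neighbours of \<open>e\<close>, and by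
  \<open>spanning_edge_unique\<close> the only new vertex is \<open>e\<close> itself, at distance
  0.\<close>

lemma eccentricity_new_spanning:
  assumes e: "e \<in> undirected_edges G1" "pverts G1 \<subseteq> e"
  shows "eccentricity J (Inl (Inr e)) = 1"
proof -
  obtain g where g: "g \<in> pverts G2" using nonempty by blast
  show ?thesis
  proof (rule eccentricity_eqI[OF finite_J])
    show "Inr g \<in> pverts J" using g by (simp add: pverts_join)
    show "graph_dist J (Inl (Inr e)) (Inr g) = 1" using dist_new_right e g by blast
    show "graph_dist J (Inl (Inr e)) u \<le> 1" if "u \<in> pverts J" for u
    proof -
      from that consider w where "u = Inl (Inl w)" "w \<in> pverts G1"
        | e' where "u = Inl (Inr e')" "e' \<in> undirected_edges G1"
        | h where "u = Inr h" "h \<in> pverts G2" by (auto simp: pverts_join)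
      then show ?thesis
      proof cases
        case 1
        then show ?thesis using dist_new_original_incident[OF e(1), of w] e(2) by auto
      next
        case 2
        then show ?thesis
          using spanning_edge_unique[OF e(2,1)] J.graph_dist_self[of u] that by simp
      next
        case 3
        then show ?thesis using dist_new_right[OF e(1), of h] by simp
      qed
    qed
  qed
qed

section \<open>Connectedness of the support graph\<close>

text \<open>The minimum is the eccentricity 2 of \<open>g\<close>: for the original vertex the lower
  bound given by its distance to \<open>g\<close> is enough.\<close>

lemma entry_original_right:
  assumes "v \<in> pverts G1" "g \<in> pverts G2"
  shows "eccentricity_entry J (Inl (Inl v)) (Inr g) \<noteq> 0"
  using graph_dist_le_eccentricity[OF finite_J, of "Inr g" "Inl (Inl v)"] assms
    dist_original_right eccentricity_right
  by (simp add: eccentricity_entry_def pverts_join)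

text \<open>Likewise the minimum is the eccentricity 3 of \<open>e\<close>, and their distance
  bounds the eccentricity of \<open>v\<close> from below.\<close>

lemma entry_new_original:
  assumes "e \<in> undirected_edges G1" "v \<in> pverts G1" "v \<notin> e"
  shows "eccentricity_entry J (Inl (Inr e)) (Inl (Inl v)) \<noteq> 0"
  using graph_dist_le_eccentricity[OF finite_J, of "Inl (Inr e)" "Inl (Inl v)"] assms
    dist_new_original_nonincident eccentricity_new_nonincident
  by (simp add: eccentricity_entry_def pverts_join J.graph_dist_commute[of "Inl (Inl v)"])

lemma entry_new_right:
  assumes "e \<in> undirected_edges G1" "pverts G1 \<subseteq> e" "g \<in> pverts G2"
  shows "eccentricity_entry J (Inl (Inr e)) (Inr g) \<noteq> 0"
  using assms dist_new_right eccentricity_new_spanning eccentricity_right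
  by (simp add: eccentricity_entry_def)

text \<open>Every vertex is linked to one fixed \<open>g\<close> by nonzero entries, so
  \<open>W\<close> contains all vertices or none.\<close>

lemma closed_set_eq_pverts:
  assumes W: "W \<subseteq> pverts J" "W \<noteq> {}"
    and cl: "\<And>x y. y \<in> W \<Longrightarrow> x \<in> pverts J \<Longrightarrow> eccentricity_entry J x y \<noteq> 0 \<Longrightarrow> x \<in> W"
  shows "W = pverts J"
proof -
  \<comment> \<open>Symmetry of the entries turns the one-way closure of \<open>W\<close> into an
    equivalence.\<close>
  have iff: "x \<in> W \<longleftrightarrow> y \<in> W"
    if "eccentricity_entry J x y \<noteq> 0" "x \<in> pverts J" "y \<in> pverts J" for x y
    using that cl J.eccentricity_entry_commute by metis
  obtain g where g: "g \<in> pverts G2" using nonempty by blast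
  obtain v where v: "v \<in> pverts G1" using arcs G1.wellformed' by fast
  have original: "Inl (Inl w) \<in> W \<longleftrightarrow> Inr g \<in> W" if "w \<in> pverts G1" for w
    using iff entry_original_right that g by (simp add: pverts_join)
  \<comment> \<open>Two vertices of \<open>G2\<close> are linked through the original vertex
    \<open>v\<close>.\<close>
  have right: "Inr h \<in> W \<longleftrightarrow> Inr g \<in> W" if "h \<in> pverts G2" for h
    using iff[OF entry_original_right[OF v that]] original[OF v] that v by (simp add: pverts_join)
  have new: "Inl (Inr e) \<in> W \<longleftrightarrow> Inr g \<in> W" if e: "e \<in> undirected_edges G1" for e
  proof (cases "pverts G1 \<subseteq> e")
    case True
    then show ?thesis using iff[OF entry_new_right[OF e True g]] e g by (simp add: pverts_join)
  next
    case False
    then obtain w where w: "w \<in> pverts G1" "w \<notin> e" by blast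
    \<comment> \<open>Here the link from \<open>e\<close> to \<open>g\<close> passes through the
      original vertex \<open>w\<close> that \<open>e\<close> misses.\<close>
    then show ?thesis
      using iff[OF entry_new_original[OF e w]] original e by (simp add: pverts_join)
  qed
  have "x \<in> W \<longleftrightarrow> Inr g \<in> W" if "x \<in> pverts J" for x
    using that original right new by (auto simp: pverts_join)
  then show ?thesis using W by blast
qed

end

theorem theorem4p1:
  fixes G1 :: "'a pair_pre_digraph" and G2 :: "'b pair_pre_digraph"
    and vs :: "(('a + 'a set) + 'b) list"
  assumes "pair_graph G1" and "Digraph_Component.connected (with_proj G1)"
    and "parcs G1 \<noteq> {}"
    and "pair_graph G2" and "Digraph_Component.connected (with_proj G2)"
    and "distinct vs" and "set vs = pverts (subdivision_edge_join G1 G2)"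
  shows "irreducible_matrix (eccentricity_matrix (subdivision_edge_join G1 G2) vs)"
proof -
  \<comment> \<open>By \<open>connected_conv\<close>, connectedness includes a nonempty vertex set;
    for \<open>G2\<close> this yields the locale assumption \<open>nonempty\<close>.\<close>
  interpret subdivision_join G1 G2
    using assms by (simp add: subdivision_join_def connected_conv)
  show ?thesis
    by (rule eccentricity_matrix_irreducibleI[OF \<open>distinct vs\<close>])
      (unfold assms(7), rule closed_set_eq_pverts)
qed

end
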